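(* Let $4\le p<n$ and let $a^\top x\le a_0$ be a facet defining inequality for $P^p_{0,n}(D)$. Let $\gamma$ be the maximum of $a(C)=\sum_{(i,j)\in C}a_{ij}$ over all simple directed cycles $C$ in $D$ with exactly $p$ arcs (such cycles use only internal nodes $1,\dots,n-1$). Set $a_{ni}:=a_{0i}$ for $i=1,\dots,n-1$. Then the inequality $$\sum_{i=1}^n\sum_{j=1,\,j\neq i}^n a_{ij}x_{ij}+(\gamma-a_0)\,x(\delta^+(n))\le\gamma$$ defines a facet of the $p$-cycle polytope $P^p_C(D_n)$.
   Context: Let $n$ be a positive integer, $V=\{0,1,\dots,n\}$, and let $D=(V,A)$ be the digraph whose arc set $A$ consists of all ordered pairs $(i,j)$ with $i\neq j$, $i,j\in V$, except that no arc enters node $0$, no arc leaves node $n$, and the arc $(0,n)$ is absent. A $(0,n)$-$p$-path is a simple directed path in $D$ from $0$ to $n$ with exactly $p$ arcs; $P^p_{0,n}(D)\subseteq\mathbb{R}^A$ is the convex hull of their incidence vectors. $D_n$ is the complete digraph on node set $\{1,\dots,n\}$ (all arcs $(i,j)$, $i\neq j$), and $P^p_C(D_n)$ is the convex hull in $\mathbb{R}^{A(D_n)}$ of the incidence vectors of all simple directed cycles in $D_n$ with exactly $p$ arcs. In $D_n$, $\delta^+(n)$ is the set of arcs leaving $n$ and $x(F)=\sum_{e\in F}x_e$. The coefficients $a_{in}$ ($1\le i\le n-1$) and $a_{ij}$ ($1\le i\neq j\le n-1$) are those of the given inequality on $D$. *)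

theory Defs
  imports "HOL-Analysis.Analysis"
begin

(* Points of R^A are represented as functions (nat \<times> nat) \<Rightarrow> real; only the
   coordinates indexed by the (finite) arc set A matter. *)
type_synonym pt = "nat \<times> nat \<Rightarrow> real"

definition arcsD :: "nat \<Rightarrow> (nat \<times> nat) set" where
  "arcsD n = {(i,j). i \<le> n \<and> j \<le> n \<and> i \<noteq> j \<and> j \<noteq> 0 \<and> i \<noteq> n \<and> (i,j) \<noteq> (0,n)}"

definition arcsDn :: "nat \<Rightarrow> (nat \<times> nat) set" where
  "arcsDn n = {(i,j). 1 \<le> i \<and> i \<le> n \<and> 1 \<le> j \<and> j \<le> n \<and> i \<noteq> j}"

definition path_arcs :: "nat list \<Rightarrow> (nat \<times> nat) set" where
  "path_arcs vs = set (zip vs (tl vs))"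

definition cycle_arcs :: "nat list \<Rightarrow> (nat \<times> nat) set" where
  "cycle_arcs vs = set (zip vs (tl vs @ [hd vs]))"

definition is_st_p_path :: "(nat \<times> nat) set \<Rightarrow> nat \<Rightarrow> nat \<Rightarrow> nat \<Rightarrow> nat list \<Rightarrow> bool" where
  "is_st_p_path A s t p vs \<longleftrightarrow> distinct vs \<and> length vs = p + 1 \<and> hd vs = s \<and> last vs = t
      \<and> path_arcs vs \<subseteq> A"

definition is_p_cycle :: "(nat \<times> nat) set \<Rightarrow> nat \<Rightarrow> nat list \<Rightarrow> bool" where
  "is_p_cycle A p vs \<longleftrightarrow> distinct vs \<and> length vs = p \<and> 2 \<le> p \<and> cycle_arcs vs \<subseteq> A"

definition incid :: "(nat \<times> nat) set \<Rightarrow> pt" where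
  "incid S = (\<lambda>e. if e \<in> S then 1 else 0)"

definition conv :: "pt set \<Rightarrow> pt set" where
  "conv S = {x. \<exists>V \<mu>. finite V \<and> V \<subseteq> S \<and> (\<forall>v\<in>V. 0 \<le> \<mu> v) \<and> sum \<mu> V = 1
                  \<and> x = (\<lambda>e. \<Sum>v\<in>V. \<mu> v * v e)}"

definition aff_indep :: "pt set \<Rightarrow> bool" where
  "aff_indep T \<longleftrightarrow> (\<forall>\<mu>. sum \<mu> T = 0 \<and> (\<forall>e. (\<Sum>v\<in>T. \<mu> v * v e) = 0) \<longrightarrow> (\<forall>v\<in>T. \<mu> v = 0))"

(* dimension: (maximum number of affinely independent points) - 1; the empty set has dim -1 *)
definition pdim :: "pt set \<Rightarrow> int" where
  "pdim S = int (Max {card T | T. finite T \<and> T \<subseteq> S \<and> aff_indep T}) - 1"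

definition lin :: "(nat \<times> nat) set \<Rightarrow> pt \<Rightarrow> pt \<Rightarrow> real" where
  "lin A a x = (\<Sum>e\<in>A. a e * x e)"

definition facet_defining :: "(nat \<times> nat) set \<Rightarrow> pt set \<Rightarrow> pt \<Rightarrow> real \<Rightarrow> bool" where
  "facet_defining A P a a0 \<longleftrightarrow> (\<forall>x\<in>P. lin A a x \<le> a0)
      \<and> pdim (P \<inter> {x. lin A a x = a0}) = pdim P - 1"

definition Ppath :: "nat \<Rightarrow> nat \<Rightarrow> pt set" where
  "Ppath n p = conv {incid (path_arcs vs) | vs. is_st_p_path (arcsD n) 0 n p vs}"

definition Pcycle :: "nat \<Rightarrow> nat \<Rightarrow> pt set" where
  "Pcycle n p = conv {incid (cycle_arcs vs) | vs. is_p_cycle (arcsDn n) p vs}"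

end

theory Submission
  imports Defs "HOL-Library.Function_Algebras"
begin

text \<open>Identifying node \<open>0\<close> with node \<open>n\<close> is an injective linear map \<open>\<phi>\<close> that sends the
  \<open>(0,n)\<close>-\<open>p\<close>-paths to the \<open>p\<close>-cycles through \<open>n\<close>. Both polytopes lie in hyperplanes missing the
  origin, so dimensions can be computed from linear spans. The new face contains the image of the old
  facet and a maximal cycle \<open>z\<close> avoiding \<open>n\<close>, which is linearly independent of it because the
  out-degree of \<open>n\<close> separates them; and it is a proper face. It remains to see that the cycle polytope
  has only one dimension more than the path polytope, i.e. that it lies in the span of \<open>z\<close> and the
  cycles through \<open>n\<close>. Modulo the latter, exchanging the first or the second node after \<open>n\<close> in a cycle
  shows that every arc \<open>(u,v)\<close> avoiding \<open>n\<close> is congruent to \<open>\<beta> + h v - h u\<close>, where \<open>h v\<close> is the arc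
  \<open>(n,v)\<close> and \<open>\<beta>\<close> is fixed. Summing around a cycle avoiding \<open>n\<close> gives \<open>p \<beta>\<close>, so any two such cycles
  are congruent.\<close>

section \<open>Linear algebra\<close>

text \<open>With this scaling and pointwise addition, the locale \<open>vector_space\<close>
  supplies span, independence and dimension on \<open>pt\<close>.\<close>

definition pscale :: "real \<Rightarrow> pt \<Rightarrow> pt" where
  "pscale r x = (\<lambda>e. r * x e)"

lemma pscale_apply [simp]: "pscale r x e = r * x e"
  by (simp add: pscale_def)

interpretation pt: vector_space pscale
  by unfold_locales (auto simp: fun_eq_iff algebra_simps)

lemma sum_pt_apply: "(\<Sum>i\<in>I. f i) e = (\<Sum>i\<in>I. f i e)" for f :: "'i \<Rightarrow> pt"
  by (induction I rule: infinite_finite_induct) simp_all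

lemma sum_pscale: "(\<Sum>v\<in>V. pscale (\<mu> v) (g v)) = (\<lambda>e. \<Sum>v\<in>V. \<mu> v * g v e)"
  by (auto simp: fun_eq_iff sum_pt_apply)

lemma lin_add: "lin A c (x + y) = lin A c x + lin A c y"
  by (simp add: lin_def sum.distrib algebra_simps)

lemma lin_pscale: "lin A c (pscale r x) = r * lin A c x"
  by (simp add: lin_def sum_distrib_left algebra_simps)

lemma lin_zero [simp]: "lin A c 0 = 0"
  by (simp add: lin_def)

lemma lin_sum: "lin A c (\<Sum>i\<in>I. f i) = (\<Sum>i\<in>I. lin A c (f i))"
  unfolding lin_def sum_pt_apply sum_distrib_left by (rule sum.swap)

lemma lin_incid: "finite A \<Longrightarrow> S \<subseteq> A \<Longrightarrow> lin A c (incid S) = sum c S"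
  unfolding lin_def by (rule sum.mono_neutral_cong_right) (auto simp: incid_def)

text \<open>An equation between two linear functionals cuts out a subspace, so it passes from
  generators to their span. Violating it then certifies that a point lies outside the span.\<close>

lemma lin_proportional_on_span:
  assumes "\<And>x. x \<in> S \<Longrightarrow> lin A c x = k * lin B d x" and "x \<in> pt.span S"
  shows "lin A c x = k * lin B d x"
proof -
  have "pt.subspace {x. lin A c x = k * lin B d x}"
    by (rule pt.subspaceI) (simp_all add: lin_add lin_pscale algebra_simps)
  then have "pt.span S \<subseteq> {x. lin A c x = k * lin B d x}"
    using assms(1) by (intro pt.span_minimal) auto
  then show ?thesis
    using assms(2) by blast
qed

section \<open>Convex hulls, affine independence and dimension\<close>

lemma conv_superset: "S \<subseteq> conv S"
proof
  fix x assume "x \<in> S"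
  then show "x \<in> conv S"
    unfolding conv_def by (intro CollectI exI[of _ "{x}"] exI[of _ "\<lambda>_. 1"]) auto
qed

lemma conv_subset_span: "conv S \<subseteq> pt.span S"
proof
  fix x assume "x \<in> conv S"
  then obtain V \<mu> where V: "V \<subseteq> S" and x: "x = (\<Sum>v\<in>V. pscale (\<mu> v) v)"
    unfolding conv_def by (auto simp: sum_pscale)
  show "x \<in> pt.span S"
    unfolding x using V by (intro pt.span_sum pt.span_scale pt.span_base) auto
qed

lemma lin_conv_le:
  assumes "\<And>x. x \<in> S \<Longrightarrow> lin A c x \<le> k" and "x \<in> conv S"
  shows "lin A c x \<le> k"
proof -
  obtain V \<mu> where V: "V \<subseteq> S" "\<forall>v\<in>V. 0 \<le> \<mu> v" "sum \<mu> V = 1"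
    and x: "x = (\<Sum>v\<in>V. pscale (\<mu> v) v)"
    using assms(2) unfolding conv_def by (auto simp: sum_pscale)
  have "lin A c x = (\<Sum>v\<in>V. \<mu> v * lin A c v)"
    by (simp add: x lin_sum lin_pscale)
  also have "\<dots> \<le> (\<Sum>v\<in>V. \<mu> v * k)"
    using V assms(1) by (intro sum_mono mult_left_mono) auto
  also have "\<dots> = k"
    using V(3) by (simp flip: sum_distrib_right)
  finally show ?thesis .
qed

lemma lin_conv_eq:
  assumes "\<And>x. x \<in> S \<Longrightarrow> lin A c x = k" and "x \<in> conv S"
  shows "lin A c x = k"
proof -
  obtain V \<mu> where V: "V \<subseteq> S" "sum \<mu> V = 1" and x: "x = (\<Sum>v\<in>V. pscale (\<mu> v) v)"
    using assms(2) unfolding conv_def by (auto simp: sum_pscale)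
  have "lin A c x = (\<Sum>v\<in>V. \<mu> v * k)"
    unfolding x lin_sum lin_pscale using V(1) assms(1) by (intro sum.cong) auto
  then show ?thesis
    using V(2) by (simp flip: sum_distrib_right)
qed

text \<open>\<open>conv\<close> attaches weights to the points themselves; under an injective map
  the points stay distinct and each image inherits its weight.\<close>

lemma conv_image_subset:
  assumes "Vector_Spaces.linear pscale pscale f" and "inj_on f S"
  shows "f ` conv S \<subseteq> conv (f ` S)"
proof (rule image_subsetI)
  interpret f: Vector_Spaces.linear pscale pscale f by fact
  fix x assume "x \<in> conv S"
  then obtain V \<mu> where V: "finite V" "V \<subseteq> S" "\<forall>v\<in>V. 0 \<le> \<mu> v" "sum \<mu> V = 1"
    and x: "x = (\<Sum>v\<in>V. pscale (\<mu> v) v)"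
    unfolding conv_def by (auto simp: sum_pscale)
  have inj: "inj_on f V"
    using assms(2) V(2) inj_on_subset by blast
  define \<nu> where "\<nu> = \<mu> \<circ> the_inv_into V f"
  have \<nu>: "\<nu> (f v) = \<mu> v" if "v \<in> V" for v
    using that inj by (simp add: \<nu>_def the_inv_into_f_f)
  have "f x = (\<Sum>w\<in>f ` V. pscale (\<nu> w) w)"
    using \<nu> by (simp add: x f.sum f.scale sum.reindex[OF inj])
  moreover have "sum \<nu> (f ` V) = 1"
    using \<nu> V(4) by (simp add: sum.reindex[OF inj])
  ultimately show "f x \<in> conv (f ` S)"
    unfolding conv_def using V \<nu>
    by (intro CollectI exI[of _ "f ` V"] exI[of _ \<nu>]) (auto simp: sum_pscale)
qed

text \<open>Applying the functional to a vanishing linear combination gives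
  \<open>k * sum \<mu> T = 0\<close>, so its coefficients sum to zero automatically.\<close>

lemma aff_indep_iff_independent:
  assumes "finite T" and "\<And>x. x \<in> T \<Longrightarrow> lin A c x = k" and "k \<noteq> 0"
  shows "aff_indep T \<longleftrightarrow> pt.independent T"
proof -
  have zero: "sum \<mu> T = 0" if "(\<Sum>v\<in>T. pscale (\<mu> v) v) = 0" for \<mu>
  proof -
    have "0 = lin A c (\<Sum>v\<in>T. pscale (\<mu> v) v)"
      using that by simp
    also have "\<dots> = (\<Sum>v\<in>T. \<mu> v * k)"
      unfolding lin_sum lin_pscale using assms(2) by (intro sum.cong) auto
    finally show ?thesis
      using \<open>k \<noteq> 0\<close> by (simp flip: sum_distrib_right)
  qed
  have "(\<forall>e. (\<Sum>v\<in>T. \<mu> v * v e) = 0) \<longleftrightarrow> (\<Sum>v\<in>T. pscale (\<mu> v) v) = 0" for \<mu>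
    by (simp add: sum_pscale fun_eq_iff)
  then show ?thesis
    unfolding aff_indep_def pt.dependent_finite[OF assms(1)] using zero by blast
qed

text \<open>A basis chosen inside \<open>S\<close> attains the maximum. The finite \<open>W\<close>
  bounds independent sets, so \<open>Max\<close> ranges over a finite set although the space of all
  functions is infinite-dimensional.\<close>

lemma pdim_eq_dim:
  assumes W: "finite W" "S \<subseteq> pt.span W"
    and hyp: "\<And>x. x \<in> S \<Longrightarrow> lin A c x = k" "k \<noteq> 0"
  shows "pdim S = int (pt.dim S) - 1"
proof -
  obtain B where B: "B \<subseteq> S" "pt.independent B" "S \<subseteq> pt.span B" "card B = pt.dim S"
    by (rule pt.basis_exists)
  have fin: "finite B"
    using pt.independent_span_bound[OF W(1) B(2)] B(1) W(2) by blast
  have iff: "aff_indep T \<longleftrightarrow> pt.independent T" if "finite T" "T \<subseteq> S" for T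
    using that hyp by (intro aff_indep_iff_independent) auto
  have bound: "card T \<le> card B" if "finite T" "T \<subseteq> S" "aff_indep T" for T
    using that pt.independent_span_bound[OF fin, of T] B(3) iff[of T] by blast
  let ?C = "{card T | T. finite T \<and> T \<subseteq> S \<and> aff_indep T}"
  have "finite ?C"
    using bound by (intro finite_subset[of ?C "{..card B}"]) auto
  moreover have "card B \<in> ?C"
    using B(1,2) fin iff by auto
  ultimately have "Max ?C = card B"
    using bound by (intro Max_eqI) auto
  then show ?thesis
    by (simp add: pdim_def B(4))
qed

text \<open>A basis of \<open>S\<close> stays independent when \<open>x\<close> joins it. The finite
  \<open>W\<close> excludes infinite bases, whose \<open>card\<close> would be 0.\<close>

lemma dim_less:
  assumes W: "finite W" "T \<subseteq> pt.span W" and "S \<subseteq> T" "x \<in> T" "x \<notin> pt.span S"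
  shows "pt.dim S < pt.dim T"
proof -
  obtain B where B: "B \<subseteq> S" "pt.independent B" "S \<subseteq> pt.span B" "card B = pt.dim S"
    by (rule pt.basis_exists)
  obtain C where C: "C \<subseteq> T" "pt.independent C" "T \<subseteq> pt.span C" "card C = pt.dim T"
    by (rule pt.basis_exists)
  have "finite C"
    using pt.independent_span_bound[OF W(1) C(2)] C(1) W(2) by blast
  have x: "x \<notin> pt.span B"
    using assms(5) pt.span_mono[OF B(1)] by blast
  then have ind: "pt.independent (insert x B)"
    using B(2) by (rule pt.independent_insertI)
  have "x \<notin> B"
    using x pt.span_base by auto
  have "insert x B \<subseteq> pt.span C"
    using B(1) C(3) assms(3,4) by blast
  then have "finite (insert x B) \<and> card (insert x B) \<le> card C"
    by (rule pt.independent_span_bound[OF \<open>finite C\<close> ind])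
  then have "Suc (card B) \<le> card C"
    using \<open>x \<notin> B\<close> by auto
  then show ?thesis
    unfolding B(4) C(4) by (rule Suc_le_lessD)
qed

lemma dim_le_Suc:
  assumes W: "finite W" "S \<subseteq> pt.span W" and T: "T \<subseteq> pt.span (insert x S)"
  shows "pt.dim T \<le> Suc (pt.dim S)"
proof -
  obtain B where B: "B \<subseteq> S" "pt.independent B" "S \<subseteq> pt.span B" "card B = pt.dim S"
    by (rule pt.basis_exists)
  have fin: "finite B"
    using pt.independent_span_bound[OF W(1) B(2)] B(1) W(2) by blast
  have "insert x S \<subseteq> pt.span (insert x B)"
    using B(3) pt.span_mono[of B "insert x B"] pt.span_base by blast
  then have "pt.span (insert x S) \<subseteq> pt.span (insert x B)"
    by (simp add: pt.span_minimal)
  then have "pt.dim T \<le> card (insert x B)"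
    using T fin by (intro pt.dim_le_card) auto
  then show ?thesis
    using B(4) fin by (metis card_insert_if le_SucI)
qed

text \<open>Injectivity is asked for on the span only: \<open>path_to_cycle\<close>, to which this
  is applied, forgets the coordinates of arcs leaving \<open>n\<close>.\<close>

lemma dim_image_inj_on:
  assumes "Vector_Spaces.linear pscale pscale f" and "inj_on f (pt.span S)"
  shows "pt.dim (f ` S) = pt.dim S"
proof -
  interpret f: Vector_Spaces.linear pscale pscale f by fact
  obtain B where B: "B \<subseteq> S" "pt.independent B" "S \<subseteq> pt.span B" "card B = pt.dim S"
    by (rule pt.basis_exists)
  have span: "pt.span B = pt.span S"
    using B(1,3) by (meson pt.span_eq pt.span_superset subset_trans)
  have "pt.dim (f ` S) = card (f ` B)"
  proof (rule pt.dim_eq_card)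
    show "pt.span (f ` B) = pt.span (f ` S)"
      by (simp add: f.span_image span)
    show "pt.independent (f ` B)"
      using B(2) assms(2) span by (intro f.independent_injective_image) auto
  qed
  also have "card (f ` B) = card B"
    using assms(2) B(1) pt.span_superset by (intro card_image) (blast intro: inj_on_subset)
  finally show ?thesis
    by (simp add: B(4))
qed

section \<open>Paths and cycles\<close>

lemma finite_arcsD [simp]: "finite (arcsD n)"
  by (rule finite_subset[of _ "{..n} \<times> {..n}"]) (auto simp: arcsD_def)

lemma finite_arcsDn [simp]: "finite (arcsDn n)"
  by (rule finite_subset[of _ "{..n} \<times> {..n}"]) (auto simp: arcsDn_def)

lemma incid_insert: "e \<notin> S \<Longrightarrow> incid (insert e S) = incid {e} + incid S"
  by (auto simp: incid_def fun_eq_iff)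

lemma incid_sum: "finite S \<Longrightarrow> incid S = (\<Sum>e\<in>S. incid {e})"
proof (induction S rule: finite_induct)
  case empty
  then show ?case by (simp add: incid_def fun_eq_iff)
next
  case (insert e S)
  then show ?case
    using incid_insert[of e S] by simp
qed

lemma incid_set: "distinct es \<Longrightarrow> incid (set es) = (\<Sum>e\<leftarrow>es. incid {e})"
  using incid_sum[of "set es"] by (simp add: sum_list_distinct_conv_sum_set)

lemma cycle_arcs_Cons: "cycle_arcs (v # vs) = set (zip (v # vs) (vs @ [v]))"
  by (simp add: cycle_arcs_def)

text \<open>As a sum over a list, the incidence vector can be split arc by arc by simplification;
  the exchange arguments rely on this.\<close>

lemma incid_cycle_arcs_Cons:
  "distinct (v # vs) \<Longrightarrow> incid (cycle_arcs (v # vs)) = (\<Sum>e\<leftarrow>zip (v # vs) (vs @ [v]). incid {e})"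
  unfolding cycle_arcs_Cons by (intro incid_set distinct_zipI1)

lemma cycle_arcs_rotate1: "cycle_arcs (xs @ [x]) = cycle_arcs (x # xs)"
proof (cases xs)
  case (Cons y ys)
  have "zip ((y # ys) @ [x]) ((ys @ [x]) @ [y]) = zip (y # ys) (ys @ [x]) @ zip [x] [y]"
    by (rule zip_append) simp
  then show ?thesis
    by (simp add: Cons cycle_arcs_def)
qed (simp add: cycle_arcs_def)

text \<open>Allows a cycle through \<open>n\<close> to be listed with \<open>n\<close>
  first.\<close>

lemma cycle_arcs_rotate: "cycle_arcs (xs @ ys) = cycle_arcs (ys @ xs)"
proof (induction xs arbitrary: ys)
  case (Cons x xs)
  then show ?case
    using Cons[of "ys @ [x]"] cycle_arcs_rotate1[of "xs @ ys" x] by simp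
qed simp

lemma length_tl_snoc_hd: "vs \<noteq> [] \<Longrightarrow> length (tl vs @ [hd vs]) = length vs"
  by (cases vs) auto

lemma fst_image_cycle_arcs: "vs \<noteq> [] \<Longrightarrow> fst ` cycle_arcs vs = set vs"
  unfolding cycle_arcs_def by (metis length_tl_snoc_hd list.set_map map_fst_zip)

lemma snd_image_cycle_arcs: "vs \<noteq> [] \<Longrightarrow> snd ` cycle_arcs vs = set vs"
proof -
  assume "vs \<noteq> []"
  then have "snd ` cycle_arcs vs = set (tl vs @ [hd vs])"
    unfolding cycle_arcs_def by (metis length_tl_snoc_hd list.set_map map_snd_zip)
  also have "\<dots> = set vs"
    using \<open>vs \<noteq> []\<close> by (cases vs) auto
  finally show ?thesis .
qed

lemma card_cycle_arcs: "distinct vs \<Longrightarrow> vs \<noteq> [] \<Longrightarrow> card (cycle_arcs vs) = length vs"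
  unfolding cycle_arcs_def by (subst distinct_card) (auto simp: distinct_zipI1 Suc_leI)

lemma cycle_arcs_loopfree:
  assumes "distinct vs" "2 \<le> length vs" "(x, y) \<in> cycle_arcs vs"
  shows "x \<noteq> y"
proof -
  obtain i where i: "i < length vs" "x = vs ! i" "y = (tl vs @ [hd vs]) ! i"
    using assms(3) unfolding cycle_arcs_def in_set_zip by auto
  have "vs \<noteq> []"
    using assms(2) by auto
  show ?thesis
  proof (cases "Suc i < length vs")
    case True
    then have "y = vs ! Suc i"
      using i by (simp add: nth_append nth_tl less_diff_conv)
    then show ?thesis
      using i True assms(1) by (simp add: nth_eq_iff_index_eq)
  next
    case False
    \<comment> \<open>This is the closing arc: it ends in the first node, which differs from the
      last as there are at least two nodes.\<close>
    then have "i = length vs - 1"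
      using i by simp
    then have "y = vs ! 0"
      using i \<open>vs \<noteq> []\<close> by (simp add: nth_append hd_conv_nth)
    moreover have "i \<noteq> 0"
      using False assms(2) by auto
    ultimately show ?thesis
      using i assms(1) \<open>vs \<noteq> []\<close> by (simp add: nth_eq_iff_index_eq)
  qed
qed

section \<open>Cycles and paths described by their nodes alone\<close>

lemma cycle_arcs_mem: "(x, y) \<in> cycle_arcs vs \<Longrightarrow> x \<in> set vs \<and> y \<in> set vs"
  unfolding cycle_arcs_def by (cases vs) (auto dest: set_zip_leftD set_zip_rightD)

lemma is_p_cycle_arcsDn_iff:
  assumes "2 \<le> p"
  shows "is_p_cycle (arcsDn n) p vs \<longleftrightarrow> distinct vs \<and> length vs = p \<and> set vs \<subseteq> {1..n}"
proof (cases "distinct vs \<and> length vs = p")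
  case True
  then have "vs \<noteq> []"
    using assms by auto
  have "cycle_arcs vs \<subseteq> arcsDn n \<longleftrightarrow> set vs \<subseteq> {1..n}"
  proof
    assume "cycle_arcs vs \<subseteq> arcsDn n"
    then have "fst ` cycle_arcs vs \<subseteq> {1..n}"
      by (auto simp: arcsDn_def)
    then show "set vs \<subseteq> {1..n}"
      using fst_image_cycle_arcs[OF \<open>vs \<noteq> []\<close>] by simp
  next
    assume *: "set vs \<subseteq> {1..n}"
    show "cycle_arcs vs \<subseteq> arcsDn n"
    proof clarify
      fix x y assume "(x, y) \<in> cycle_arcs vs"
      then have "x \<in> {1..n}" "y \<in> {1..n}" "x \<noteq> y"
        using * cycle_arcs_mem cycle_arcs_loopfree True assms by blast+
      then show "(x, y) \<in> arcsDn n"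
        by (simp add: arcsDn_def)
    qed
  qed
  then show ?thesis
    using True assms by (simp add: is_p_cycle_def)
qed (auto simp: is_p_cycle_def)

text \<open>Every node of a cycle is a tail and a head, whereas \<open>n\<close> is never a tail and
  \<open>0\<close> never a head in \<open>D\<close>.\<close>

lemma is_p_cycle_arcsD_iff:
  assumes "2 \<le> p"
  shows "is_p_cycle (arcsD n) p vs \<longleftrightarrow> distinct vs \<and> length vs = p \<and> set vs \<subseteq> {1..<n}"
proof (cases "distinct vs \<and> length vs = p")
  case True
  then have "vs \<noteq> []"
    using assms by auto
  have "cycle_arcs vs \<subseteq> arcsD n \<longleftrightarrow> set vs \<subseteq> {1..<n}"
  proof
    assume "cycle_arcs vs \<subseteq> arcsD n"
    then have "fst ` cycle_arcs vs \<subseteq> {..<n}" "snd ` cycle_arcs vs \<subseteq> {1..}"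
      by (auto simp: arcsD_def)
    then show "set vs \<subseteq> {1..<n}"
      using fst_image_cycle_arcs[OF \<open>vs \<noteq> []\<close>] snd_image_cycle_arcs[OF \<open>vs \<noteq> []\<close>] by auto
  next
    assume *: "set vs \<subseteq> {1..<n}"
    show "cycle_arcs vs \<subseteq> arcsD n"
    proof clarify
      fix x y assume "(x, y) \<in> cycle_arcs vs"
      then have "x \<in> {1..<n}" "y \<in> {1..<n}" "x \<noteq> y"
        using * cycle_arcs_mem cycle_arcs_loopfree True assms by blast+
      then show "(x, y) \<in> arcsD n"
        by (simp add: arcsD_def)
    qed
  qed
  then show ?thesis
    using True assms by (simp add: is_p_cycle_def)
qed (auto simp: is_p_cycle_def)

text \<open>These are the arcs leaving the nodes of \<open>ws\<close>, common to the path
  \<open>0 # ws @ [n]\<close> and the cycle \<open>n # ws\<close>, which differ only in their first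
  arc.\<close>

definition inner_arcs :: "nat \<Rightarrow> nat list \<Rightarrow> (nat \<times> nat) set" where
  "inner_arcs n ws = set (zip ws (tl ws @ [n]))"

lemma path_arcs_inner: "ws \<noteq> [] \<Longrightarrow> path_arcs (0 # ws @ [n]) = insert (0, hd ws) (inner_arcs n ws)"
proof (cases ws)
  case (Cons w us)
  have "zip ((w # us) @ [n]) ((us @ [n]) @ []) = zip (w # us) (us @ [n]) @ zip [n] []"
    by (rule zip_append) simp
  then show ?thesis
    by (simp add: Cons path_arcs_def inner_arcs_def)
qed simp

lemma cycle_arcs_inner: "ws \<noteq> [] \<Longrightarrow> cycle_arcs (n # ws) = insert (n, hd ws) (inner_arcs n ws)"
  by (cases ws) (auto simp: cycle_arcs_def inner_arcs_def)

lemma inner_arcs_mem: "(x, y) \<in> inner_arcs n ws \<Longrightarrow> x \<in> set ws \<and> (y \<in> set ws \<or> y = n)"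
  unfolding inner_arcs_def by (cases ws) (auto dest: set_zip_leftD set_zip_rightD)

text \<open>Reduces a path to its internal nodes; \<open>2 \<le> p\<close> makes their list
  nonempty, so the absent arc \<open>(0,n)\<close> does not occur.\<close>

lemma is_st_p_path_arcsD_iff:
  assumes "2 \<le> p" "0 < n"
  shows "is_st_p_path (arcsD n) 0 n p vs \<longleftrightarrow>
    (\<exists>ws. vs = 0 # ws @ [n] \<and> distinct ws \<and> length ws = p - 1 \<and> set ws \<subseteq> {1..<n})"
proof
  assume *: "is_st_p_path (arcsD n) 0 n p vs"
  have "length vs = p + 1" "hd vs = 0" "last vs = n"
    using * by (simp_all add: is_st_p_path_def)
  then obtain us where vs: "vs = 0 # us" "us \<noteq> []" "last us = n"
    using assms by (cases vs) (auto split: if_splits)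
  obtain ws where us: "us = ws @ [n]"
    using vs by (metis append_butlast_last_id)
  have ws: "distinct ws" "0 \<notin> set ws" "n \<notin> set ws" "length ws = p - 1" "path_arcs vs \<subseteq> arcsD n"
    using * unfolding is_st_p_path_def vs us by auto
  have "ws \<noteq> []"
    using ws(4) assms by auto
  have "length (tl ws @ [n]) = length ws"
    using \<open>ws \<noteq> []\<close> by (cases ws) auto
  then have "fst ` inner_arcs n ws = set ws"
    unfolding inner_arcs_def by (metis list.set_map map_fst_zip)
  moreover have "inner_arcs n ws \<subseteq> arcsD n"
    using ws(5) path_arcs_inner[OF \<open>ws \<noteq> []\<close>] unfolding vs us by auto
  then have "fst ` inner_arcs n ws \<subseteq> {..<n}"
    by (auto simp: arcsD_def)
  ultimately have "set ws \<subseteq> {1..<n}"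
    using ws(2) by (force simp: Suc_le_eq)
  then show "\<exists>ws. vs = 0 # ws @ [n] \<and> distinct ws \<and> length ws = p - 1 \<and> set ws \<subseteq> {1..<n}"
    using vs us ws by auto
next
  assume "\<exists>ws. vs = 0 # ws @ [n] \<and> distinct ws \<and> length ws = p - 1 \<and> set ws \<subseteq> {1..<n}"
  then obtain ws where ws: "vs = 0 # ws @ [n]" "distinct ws" "length ws = p - 1" "set ws \<subseteq> {1..<n}"
    by blast
  have "ws \<noteq> []"
    using ws(3) assms by auto
  have "inner_arcs n ws \<subseteq> arcsD n"
  proof clarify
    fix x y assume xy: "(x, y) \<in> inner_arcs n ws"
    \<comment> \<open>The inner arcs also belong to the cycle \<open>n # ws\<close>, so they inherit
      its loop-freeness.\<close>
    have "distinct (n # ws)" "2 \<le> length (n # ws)"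
      using ws assms(1) by auto
    then have "x \<noteq> y"
      using xy cycle_arcs_inner[OF \<open>ws \<noteq> []\<close>] by (intro cycle_arcs_loopfree[of "n # ws"]) auto
    moreover have "x \<in> {1..<n}" "y \<in> {1..n}"
      using inner_arcs_mem[OF xy] ws(4) assms(2) by auto
    ultimately show "(x, y) \<in> arcsD n"
      by (simp add: arcsD_def)
  qed
  moreover have "(0, hd ws) \<in> arcsD n"
    using hd_in_set[OF \<open>ws \<noteq> []\<close>] ws(4) by (auto simp: arcsD_def)
  ultimately show "is_st_p_path (arcsD n) 0 n p vs"
    using ws assms unfolding is_st_p_path_def by (auto simp: path_arcs_inner[OF \<open>ws \<noteq> []\<close>])
qed

section \<open>Cycles modulo the span of the cycles through a node\<close>

text \<open>The list \<open>ws\<close> plays the role of the internal nodes of a path, which makes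
  these vectors the images of the path vectors.\<close>

definition rooted_cycles :: "nat \<Rightarrow> nat \<Rightarrow> pt set" where
  "rooted_cycles n p =
    {incid (cycle_arcs (n # ws)) | ws. distinct ws \<and> length ws = p - 1 \<and> set ws \<subseteq> {1..<n}}"

lemma obtain_distinct_list:
  assumes "finite S" "k \<le> card S"
  obtains xs where "distinct xs" "length xs = k" "set xs \<subseteq> S"
proof -
  obtain T where T: "T \<subseteq> S" "card T = k" "finite T"
    by (rule obtain_subset_with_card_n[OF assms(2)])
  then obtain xs where "set xs = T" "distinct xs"
    using finite_distinct_list by blast
  then show thesis
    using that[of xs] T distinct_card[of xs] by auto
qed

text \<open>The difference of two \<open>p\<close>-cycles through \<open>n\<close> that differ only in the node after \<open>n\<close>; the next
  lemma does the same one node further, which needs three nodes besides \<open>n\<close> and hence \<open>4 \<le> p\<close>.\<close>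

lemma first_node_exchange:
  assumes "4 \<le> p" "p < n" "{u, v, w} \<subseteq> {1..<n}" "distinct [u, v, w]"
  shows "(incid {(n, u)} + incid {(u, v)}) - (incid {(n, w)} + incid {(w, v)})
    \<in> pt.span (rooted_cycles n p)"
proof -
  \<comment> \<open>A cycle \<open>n # u # v # xs\<close> needs \<open>p - 3\<close> further nodes;
    as \<open>p \<le> n - 1\<close>, enough internal ones remain outside \<open>u\<close>,
    \<open>v\<close>, \<open>w\<close>.\<close>
  have "card ({1..<n} - {u, v, w}) = n - 1 - 3"
    using assms by (subst card_Diff_subset) auto
  then have "p - 3 \<le> card ({1..<n} - {u, v, w})"
    using assms by simp
  then obtain xs where xs: "distinct xs" "length xs = p - 3" "set xs \<subseteq> {1..<n} - {u, v, w}"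
    by (rule obtain_distinct_list[OF finite_Diff[OF finite_atLeastLessThan]])
  \<comment> \<open>Only the first node after \<open>n\<close> varies; \<open>?r\<close> collects
    the arcs from \<open>v\<close> back to \<open>n\<close>, which cancel in the difference.\<close>
  let ?c = "\<lambda>u. incid (cycle_arcs (n # u # v # xs))"
  let ?r = "\<Sum>e\<leftarrow>zip (v # xs) (xs @ [n]). incid {e}"
  have c: "?c x \<in> pt.span (rooted_cycles n p)" "?c x = (incid {(n, x)} + incid {(x, v)}) + ?r"
    if "x = u \<or> x = w" for x
  proof -
    have "n \<notin> {u, v, w}" "n \<notin> set xs" "set xs \<inter> {u, v, w} = {}"
      using xs(3) assms(3) by auto
    then have dist: "distinct (n # x # v # xs)"
      using that xs(1) assms(4) by (elim disjE) (simp_all add: eq_commute)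
    show "?c x \<in> pt.span (rooted_cycles n p)"
      unfolding rooted_cycles_def using that xs(2,3) assms(1,3) dist
      by (intro pt.span_base CollectI exI[of _ "x # v # xs"] conjI refl) auto
    show "?c x = (incid {(n, x)} + incid {(x, v)}) + ?r"
      unfolding incid_cycle_arcs_Cons[OF dist] by (simp add: add.assoc)
  qed
  have "?c u - ?c w \<in> pt.span (rooted_cycles n p)"
    using c(1) by (intro pt.span_diff) auto
  moreover have "?c u - ?c w = (incid {(n, u)} + incid {(u, v)}) - (incid {(n, w)} + incid {(w, v)})"
    by (simp only: c(2) add_diff_cancel_right simp_thms)
  ultimately show ?thesis by (simp only:)
qed

lemma second_node_exchange:
  assumes "4 \<le> p" "p < n" "{u, v, w, x} \<subseteq> {1..<n}" "distinct [u, v, w, x]"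
  shows "(incid {(u, v)} + incid {(v, w)}) - (incid {(u, x)} + incid {(x, w)})
    \<in> pt.span (rooted_cycles n p)"
proof -
  have "card ({1..<n} - {u, v, w, x}) = n - 1 - 4"
    using assms by (subst card_Diff_subset) auto
  then have "p - 4 \<le> card ({1..<n} - {u, v, w, x})"
    using assms by simp
  then obtain xs where xs: "distinct xs" "length xs = p - 4" "set xs \<subseteq> {1..<n} - {u, v, w, x}"
    by (rule obtain_distinct_list[OF finite_Diff[OF finite_atLeastLessThan]])
  \<comment> \<open>For \<open>p = 4\<close> the list \<open>xs\<close> is empty and
    \<open>?r\<close> is just the arc from \<open>w\<close> back to \<open>n\<close>.\<close>
  let ?c = "\<lambda>v. incid (cycle_arcs (n # u # v # w # xs))"
  let ?r = "\<Sum>e\<leftarrow>zip (w # xs) (xs @ [n]). incid {e}"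
  have c: "?c y \<in> pt.span (rooted_cycles n p)"
    "?c y = incid {(n, u)} + ((incid {(u, y)} + incid {(y, w)}) + ?r)"
    if "y = v \<or> y = x" for y
  proof -
    have "n \<notin> {u, v, w, x}" "n \<notin> set xs" "set xs \<inter> {u, v, w, x} = {}"
      using xs(3) assms(3) by auto
    then have dist: "distinct (n # u # y # w # xs)"
      using that xs(1) assms(4) by (elim disjE) (simp_all add: eq_commute)
    show "?c y \<in> pt.span (rooted_cycles n p)"
      unfolding rooted_cycles_def using that xs(2,3) assms(1,3) dist
      by (intro pt.span_base CollectI exI[of _ "u # y # w # xs"] conjI refl) auto
    show "?c y = incid {(n, u)} + ((incid {(u, y)} + incid {(y, w)}) + ?r)"
      unfolding incid_cycle_arcs_Cons[OF dist] by (simp add: add.assoc)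
  qed
  have "?c v - ?c x \<in> pt.span (rooted_cycles n p)"
    using c(1) by (intro pt.span_diff) auto
  moreover have "?c v - ?c x = (incid {(u, v)} + incid {(v, w)}) - (incid {(u, x)} + incid {(x, w)})"
    by (simp only: c(2) add_diff_cancel_left add_diff_cancel_right simp_thms)
  ultimately show ?thesis by (simp only:)
qed

text \<open>By the first exchange, \<open>(n,u)\<close> plus \<open>(u,v)\<close> depends modulo the
  span only on \<open>v\<close>; call it \<open>s v\<close>. By the second, \<open>s v\<close> minus
  \<open>(n,v)\<close> does not depend on \<open>v\<close>; this constant is
  \<open>\<beta>\<close>.\<close>

lemma inner_arc_potential:
  assumes "4 \<le> p" "p < n"
  shows "\<exists>\<beta>. \<forall>u\<in>{1..<n}. \<forall>v\<in>{1..<n}. u \<noteq> v \<longrightarrow>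
    incid {(u, v)} - (\<beta> + (incid {(n, v)} - incid {(n, u)})) \<in> pt.span (rooted_cycles n p)"
proof -
  let ?U = "pt.span (rooted_cycles n p)"
  define E where "E u v = incid {(u, v)}" for u v
  \<comment> \<open>An arbitrary reference node different from \<open>v\<close>, used to choose a
    representative \<open>s v\<close>.\<close>
  define \<sigma> where "\<sigma> v = (if v = 1 then 2 else 1 :: nat)" for v :: nat
  define s where "s v = E n (\<sigma> v) + E (\<sigma> v) v" for v
  have \<sigma>: "\<sigma> v \<in> {1..<n}" "\<sigma> v \<noteq> v" for v
    using assms by (auto simp: \<sigma>_def)
  have s: "(E n u + E u v) - s v \<in> ?U" if "u \<in> {1..<n}" "v \<in> {1..<n}" "u \<noteq> v" for u v
  proof (cases "u = \<sigma> v")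
    case True
    then show ?thesis by (simp add: s_def pt.span_zero)
  next
    case False
    then show ?thesis
      unfolding s_def E_def using that \<sigma>[of v] by (intro first_node_exchange assms) auto
  qed
  have \<beta>: "(s v - E n v) - (s x - E n x) \<in> ?U" if "v \<in> {1..<n}" "x \<in> {1..<n}" for v x
  proof (cases "v = x")
    case True
    then show ?thesis by (simp add: pt.span_zero)
  next
    case False
    \<comment> \<open>There are at least four internal nodes, so two more, \<open>u\<close> and
      \<open>w\<close>, can be placed around \<open>v\<close> and \<open>x\<close>.\<close>
    have "card ({1..<n} - {v, x}) = n - 1 - 2"
      using that False by (subst card_Diff_subset) auto
    then have "2 \<le> card ({1..<n} - {v, x})"
      using assms by simp
    then obtain xs where xs: "distinct xs" "length xs = 2" "set xs \<subseteq> {1..<n} - {v, x}"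
      by (rule obtain_distinct_list[OF finite_Diff[OF finite_atLeastLessThan]])
    then obtain u w where "xs = [u, w]"
      by (auto simp: length_Suc_conv numeral_2_eq_2)
    then have uw: "u \<in> {1..<n}" "w \<in> {1..<n}" "distinct [u, v, w, x]"
      using xs False by auto
    have ex: "(E u v + E v w) - (E u x + E x w) \<in> ?U"
      unfolding E_def using uw that by (intro second_node_exchange assms) auto
    have "(E n u + E u v) - s v \<in> ?U" "(E n v + E v w) - s w \<in> ?U"
      "(E n u + E u x) - s x \<in> ?U" "(E n x + E x w) - s w \<in> ?U"
      by (rule s; use uw that in auto)+
    \<comment> \<open>Each arc of the second exchange is rewritten through \<open>s\<close>; the
      terms \<open>s w\<close> and \<open>E n u\<close> cancel.\<close>
    from pt.span_add[OF pt.span_add[OF pt.span_diff[OF pt.span_diff[OF ex this(1)] this(2)] this(3)] this(4)]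
    have "((E u v + E v w) - (E u x + E x w))
        - ((E n u + E u v) - s v) - ((E n v + E v w) - s w)
        + ((E n u + E u x) - s x) + ((E n x + E x w) - s w) \<in> ?U" .
    also have "((E u v + E v w) - (E u x + E x w))
        - ((E n u + E u v) - s v) - ((E n v + E v w) - s w)
        + ((E n u + E u x) - s x) + ((E n x + E x w) - s w) = (s v - E n v) - (s x - E n x)"
      by (simp add: algebra_simps)
    finally show ?thesis .
  qed
  have "E u v - ((s 1 - E n 1) + (E n v - E n u)) \<in> ?U"
    if "u \<in> {1..<n}" "v \<in> {1..<n}" "u \<noteq> v" for u v
  proof -
    have "((E n u + E u v) - s v) + ((s v - E n v) - (s 1 - E n 1)) \<in> ?U"
      using that assms by (intro pt.span_add s \<beta>) auto
    also have "((E n u + E u v) - s v) + ((s v - E n v) - (s 1 - E n 1))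
        = E u v - ((s 1 - E n 1) + (E n v - E n u))"
      by (simp add: algebra_simps)
    finally show ?thesis .
  qed
  then show ?thesis
    unfolding E_def by blast
qed

text \<open>Potential differences cancel around a cycle, so either cycle is congruent to
  \<open>p\<close> copies of the same \<open>\<beta>\<close>.\<close>

lemma inner_cycles_congruent:
  assumes "4 \<le> p" "p < n"
    and "distinct vs" "length vs = p" "set vs \<subseteq> {1..<n}"
    and "distinct vs'" "length vs' = p" "set vs' \<subseteq> {1..<n}"
  shows "incid (cycle_arcs vs) - incid (cycle_arcs vs') \<in> pt.span (rooted_cycles n p)"
proof -
  let ?U = "pt.span (rooted_cycles n p)"
  obtain \<beta> where \<beta>: "\<forall>u\<in>{1..<n}. \<forall>v\<in>{1..<n}. u \<noteq> v \<longrightarrow>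
      incid {(u, v)} - (\<beta> + (incid {(n, v)} - incid {(n, u)})) \<in> ?U"
    using inner_arc_potential[OF assms(1,2)] by (rule exE)
  define h where "h u = incid {(n, u)}" for u
  have "incid (cycle_arcs us) - (\<Sum>i<p. \<beta>) \<in> ?U"
    if us: "distinct us" "length us = p" "set us \<subseteq> {1..<n}" for us
  proof -
    let ?C = "cycle_arcs us"
    have "us \<noteq> []"
      using us(2) assms(1) by auto
    have fin: "finite ?C" and card: "card ?C = p"
      using card_cycle_arcs[OF us(1) \<open>us \<noteq> []\<close>] us(2) by (auto simp: cycle_arcs_def)
    \<comment> \<open>Arcs and nodes are equally many, so the projections onto tails and heads,
      being onto, are injective.\<close>
    have "bij_betw fst ?C (set us)" "bij_betw snd ?C (set us)"
      using fst_image_cycle_arcs[OF \<open>us \<noteq> []\<close>] snd_image_cycle_arcs[OF \<open>us \<noteq> []\<close>]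
        card distinct_card[OF us(1)] us(2) fin by (auto simp: bij_betw_def intro!: eq_card_imp_inj_on)
    then have tele: "(\<Sum>e\<in>?C. h (snd e)) = (\<Sum>e\<in>?C. h (fst e))"
      using sum.reindex_bij_betw[of fst ?C "set us" h] sum.reindex_bij_betw[of snd ?C "set us" h] by simp
    have "(\<Sum>e\<in>?C. incid {e} - (\<beta> + (h (snd e) - h (fst e)))) \<in> ?U"
    proof (rule pt.span_sum)
      fix e assume "e \<in> ?C"
      then obtain u v where e: "e = (u, v)" "(u, v) \<in> ?C"
        by (cases e) auto
      then have "u \<noteq> v" "u \<in> {1..<n}" "v \<in> {1..<n}"
        using cycle_arcs_loopfree[OF us(1) _ e(2)] cycle_arcs_mem[OF e(2)] us assms(1) by auto
      then show "incid {e} - (\<beta> + (h (snd e) - h (fst e))) \<in> ?U"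
        unfolding e h_def using \<beta> by simp
    qed
    also have "(\<Sum>e\<in>?C. incid {e} - (\<beta> + (h (snd e) - h (fst e)))) = incid ?C - (\<Sum>e\<in>?C. \<beta>)"
      unfolding sum_subtractf sum.distrib tele incid_sum[OF fin] by simp
    also have "(\<Sum>e\<in>?C. \<beta>) = (\<Sum>i<p. \<beta>)"
      using card by simp
    finally show ?thesis .
  qed
  from pt.span_diff[OF this[OF assms(3-5)] this[OF assms(6-8)]] show ?thesis
    by simp
qed

section \<open>Lifting paths to cycles\<close>

text \<open>The linear map that identifies node \<open>0\<close> with node \<open>n\<close>.\<close>

definition path_to_cycle :: "nat \<Rightarrow> pt \<Rightarrow> pt" where
  "path_to_cycle n x = (\<lambda>(i, j). if i = n then x (0, j) else if i = 0 then 0 else x (i, j))"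

lemma linear_path_to_cycle: "Vector_Spaces.linear pscale pscale (path_to_cycle n)"
  by unfold_locales (auto simp: path_to_cycle_def fun_eq_iff)

lemma inj_on_path_to_cycle:
  assumes "0 < n"
  shows "inj_on (path_to_cycle n) {x. \<forall>e. e \<notin> arcsD n \<longrightarrow> x e = 0}"
proof (rule inj_onI, rule ext)
  fix x y :: pt and e :: "nat \<times> nat"
  assume x: "x \<in> {x. \<forall>e. e \<notin> arcsD n \<longrightarrow> x e = 0}" and y: "y \<in> {x. \<forall>e. e \<notin> arcsD n \<longrightarrow> x e = 0}"
    and eq: "path_to_cycle n x = path_to_cycle n y"
  obtain i j where e: "e = (i, j)"
    by (cases e)
  show "x e = y e"
  proof (cases "e \<in> arcsD n")
    case True
    then have "i \<noteq> n"
      by (simp add: e arcsD_def)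
    then show ?thesis
      \<comment> \<open>The coordinate of the image that stores \<open>x e\<close>: an arc out of
        \<open>0\<close> reappears as an arc out of \<open>n\<close>.\<close>
      using fun_cong[OF eq, of "(if i = 0 then n else i, j)"] assms
      by (auto simp: e path_to_cycle_def split: if_splits)
  next
    case False
    then show ?thesis
      using x y by (metis (mono_tags, lifting) mem_Collect_eq)
  qed
qed

lemma inj_on_path_to_cycle_span:
  assumes "0 < n" "\<And>x e. x \<in> S \<Longrightarrow> e \<notin> arcsD n \<Longrightarrow> x e = 0"
  shows "inj_on (path_to_cycle n) (pt.span S)"
proof -
  have "pt.subspace {x. \<forall>e. e \<notin> arcsD n \<longrightarrow> x e = 0}"
    by (rule pt.subspaceI) simp_all
  then have "pt.span S \<subseteq> {x. \<forall>e. e \<notin> arcsD n \<longrightarrow> x e = 0}"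
    using assms(2) by (intro pt.span_minimal) auto
  then show ?thesis
    using inj_on_path_to_cycle[OF assms(1)] inj_on_subset by blast
qed

text \<open>Renaming the tail \<open>0\<close> to \<open>n\<close> is a bijection from the arcs of
  \<open>D\<close> to those of the complete digraph; the absent \<open>(0,n)\<close> corresponds to
  the absent loop at \<open>n\<close>.\<close>

lemma lin_path_to_cycle:
  assumes "0 < n"
  shows "lin (arcsDn n) c (path_to_cycle n x) = lin (arcsD n) (\<lambda>(i, j). c (if i = 0 then n else i, j)) x"
proof -
  let ?t = "\<lambda>(i, j). (if i = 0 then n else i, j)"
  have "bij_betw ?t (arcsD n) (arcsDn n)"
    by (rule bij_betw_byWitness[where f' = "\<lambda>(i, j). (if i = n then 0 else i, j)"])
      (use assms in \<open>auto simp: arcsD_def arcsDn_def split: if_splits\<close>)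
  then have "lin (arcsDn n) c (path_to_cycle n x)
      = (\<Sum>e\<in>arcsD n. c (?t e) * path_to_cycle n x (?t e))"
    unfolding lin_def by (rule sum.reindex_bij_betw[symmetric])
  also have "\<dots> = (\<Sum>e\<in>arcsD n. (\<lambda>(i, j). c (if i = 0 then n else i, j)) e * x e)"
    by (rule sum.cong) (auto simp: arcsD_def path_to_cycle_def)
  finally show ?thesis
    by (simp only: lin_def)
qed

text \<open>Inner arcs have tails other than \<open>0\<close> and \<open>n\<close>, so the map
  leaves their coordinates alone and moves only the first arc.\<close>

lemma path_to_cycle_incid:
  assumes "ws \<noteq> []" "set ws \<subseteq> {1..<n}"
  shows "path_to_cycle n (incid (path_arcs (0 # ws @ [n]))) = incid (cycle_arcs (n # ws))"
proof (rule ext)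
  fix e :: "nat \<times> nat"
  obtain i j where e: "e = (i, j)"
    by (cases e)
  have "(0, j) \<notin> inner_arcs n ws" "(n, j) \<notin> inner_arcs n ws"
    using inner_arcs_mem[of _ j n ws] assms(2) by force+
  then show "path_to_cycle n (incid (path_arcs (0 # ws @ [n]))) e = incid (cycle_arcs (n # ws)) e"
    unfolding path_arcs_inner[OF assms(1)] cycle_arcs_inner[OF assms(1)]
    by (auto simp: e path_to_cycle_def incid_def)
qed

lemma image_path_vertices:
  assumes "2 \<le> p" "0 < n"
  shows "path_to_cycle n ` {incid (path_arcs vs) | vs. is_st_p_path (arcsD n) 0 n p vs}
    = rooted_cycles n p"
proof -
  have ne: "ws \<noteq> []" if "length ws = p - 1" for ws :: "nat list"
    using that assms(1) by auto
  show ?thesis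
    unfolding is_st_p_path_arcsD_iff[OF assms] rooted_cycles_def
  proof (intro subset_antisym subsetI)
    fix y
    assume "y \<in> path_to_cycle n ` {incid (path_arcs vs) | vs. \<exists>ws. vs = 0 # ws @ [n] \<and>
      distinct ws \<and> length ws = p - 1 \<and> set ws \<subseteq> {1..<n}}"
    then obtain ws where "distinct ws" "length ws = p - 1" "set ws \<subseteq> {1..<n}"
      "y = path_to_cycle n (incid (path_arcs (0 # ws @ [n])))"
      by blast
    then show "y \<in> {incid (cycle_arcs (n # ws)) | ws.
      distinct ws \<and> length ws = p - 1 \<and> set ws \<subseteq> {1..<n}}"
      using path_to_cycle_incid[OF ne] by blast
  next
    fix y
    assume "y \<in> {incid (cycle_arcs (n # ws)) | ws.
      distinct ws \<and> length ws = p - 1 \<and> set ws \<subseteq> {1..<n}}"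
    then obtain ws where ws: "distinct ws" "length ws = p - 1" "set ws \<subseteq> {1..<n}"
      "y = incid (cycle_arcs (n # ws))"
      by blast
    then have "y = path_to_cycle n (incid (path_arcs (0 # ws @ [n])))"
      using path_to_cycle_incid[OF ne] by simp
    then show "y \<in> path_to_cycle n ` {incid (path_arcs vs) | vs. \<exists>ws. vs = 0 # ws @ [n] \<and>
      distinct ws \<and> length ws = p - 1 \<and> set ws \<subseteq> {1..<n}}"
      using ws by blast
  qed
qed

text \<open>A cycle either passes through \<open>n\<close> and can be rotated to start there, or
  avoids \<open>n\<close> and is then a cycle of \<open>D\<close>.\<close>

lemma cycle_vertices_eq:
  assumes "2 \<le> p" "0 < n"
  shows "{incid (cycle_arcs vs) | vs. is_p_cycle (arcsDn n) p vs}
    = rooted_cycles n p \<union> {incid (cycle_arcs vs) | vs. is_p_cycle (arcsD n) p vs}" (is "?L = ?R")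
proof (intro subset_antisym subsetI)
  fix y assume "y \<in> ?L"
  then obtain vs where vs: "distinct vs" "length vs = p" "set vs \<subseteq> {1..n}" "y = incid (cycle_arcs vs)"
    unfolding is_p_cycle_arcsDn_iff[OF assms(1)] by blast
  show "y \<in> ?R"
  proof (cases "n \<in> set vs")
    case True
    then obtain us ws where split: "vs = us @ n # ws"
      by (meson split_list)
    have "set (ws @ us) \<subseteq> {1..<n}"
      using vs(1,3) unfolding split by (force simp: less_le)
    moreover have "y = incid (cycle_arcs (n # (ws @ us)))"
      unfolding vs(4) split cycle_arcs_rotate[of us] by simp
    ultimately have "y \<in> rooted_cycles n p"
      unfolding rooted_cycles_def using vs(1,2) split by (intro CollectI exI[of _ "ws @ us"]) auto
    then show ?thesis by blast
  next
    case False
    then have "set vs \<subseteq> {1..<n}"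
      using vs(3) by (force simp: less_le)
    then show ?thesis
      unfolding is_p_cycle_arcsD_iff[OF assms(1)] using vs by blast
  qed
next
  fix y assume "y \<in> ?R"
  then obtain vs where "distinct vs" "length vs = p" "set vs \<subseteq> {1..n}" "y = incid (cycle_arcs vs)"
  proof
    assume "y \<in> rooted_cycles n p"
    then obtain ws where ws: "distinct ws" "length ws = p - 1" "set ws \<subseteq> {1..<n}"
      "y = incid (cycle_arcs (n # ws))"
      unfolding rooted_cycles_def by blast
    show thesis
      by (rule that[of "n # ws"]) (use ws assms in auto)
  next
    assume "y \<in> {incid (cycle_arcs vs) | vs. is_p_cycle (arcsD n) p vs}"
    then obtain vs where "distinct vs" "length vs = p" "set vs \<subseteq> {1..<n}" "y = incid (cycle_arcs vs)"
      unfolding is_p_cycle_arcsD_iff[OF assms(1)] by blast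
    then show thesis
      by (intro that[of vs]) auto
  qed
  then show "y \<in> ?L"
    unfolding is_p_cycle_arcsDn_iff[OF assms(1)] by blast
qed

section \<open>Finiteness and the source-degree hyperplane\<close>

lemma finite_p_cycles: "finite {vs. is_p_cycle (arcsDn n) p vs}"
proof (cases "2 \<le> p")
  case True
  then have "{vs. is_p_cycle (arcsDn n) p vs} \<subseteq> {vs. set vs \<subseteq> {1..n} \<and> length vs = p}"
    by (auto simp: is_p_cycle_arcsDn_iff)
  then show ?thesis
    using finite_lists_length_eq[of "{1..n}" p] finite_subset by blast
qed (simp add: is_p_cycle_def)

lemma finite_st_p_paths: "2 \<le> p \<Longrightarrow> 0 < n \<Longrightarrow> finite {vs. is_st_p_path (arcsD n) 0 n p vs}"
proof -
  assume "2 \<le> p" "0 < n"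
  then have "{vs. is_st_p_path (arcsD n) 0 n p vs} \<subseteq> {vs. set vs \<subseteq> {0..n} \<and> length vs = p + 1}"
    by (force simp: is_st_p_path_arcsD_iff)
  then show ?thesis
    using finite_lists_length_eq[of "{0..n}" "p + 1"] finite_subset by blast
qed

text \<open>Places all path vectors in a hyperplane missing the origin: a path leaves
  \<open>0\<close> exactly once.\<close>

lemma path_vertex_source_degree:
  assumes "2 \<le> p" "0 < n" "is_st_p_path (arcsD n) 0 n p vs"
  shows "lin (arcsD n) (\<lambda>(i, j). if i = 0 then 1 else 0) (incid (path_arcs vs)) = 1"
proof -
  obtain ws where ws: "vs = 0 # ws @ [n]" "length ws = p - 1" "set ws \<subseteq> {1..<n}"
    using assms(3) unfolding is_st_p_path_arcsD_iff[OF assms(1,2)] by blast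
  have "ws \<noteq> []"
    using ws(2) assms(1) by auto
  have "i \<noteq> 0" if "(i, j) \<in> inner_arcs n ws" for i j
    using inner_arcs_mem[OF that] ws(3) by auto
  then have "(\<Sum>e\<in>inner_arcs n ws. (\<lambda>(i, j). if i = 0 then 1 else 0 :: real) e) = 0"
    and "(0, hd ws) \<notin> inner_arcs n ws"
    by (auto intro!: sum.neutral)
  moreover have "finite (inner_arcs n ws)"
    by (simp add: inner_arcs_def)
  moreover have "path_arcs vs \<subseteq> arcsD n"
    using assms(3) by (simp add: is_st_p_path_def)
  ultimately show ?thesis
    by (subst lin_incid) (simp_all add: ws(1) path_arcs_inner[OF \<open>ws \<noteq> []\<close>])
qed

section \<open>The facet property of the lifted inequality\<close>

theorem theorem0:
  fixes n p :: nat and a :: "nat \<times> nat \<Rightarrow> real" and a0 :: real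
  assumes "4 \<le> p" and "p < n"
    and "facet_defining (arcsD n) (Ppath n p) a a0"
  shows "let \<gamma> = Max {(\<Sum>e\<in>cycle_arcs vs. a e) | vs. is_p_cycle (arcsD n) p vs};
             b = (\<lambda>(i,j). if i = n then a (0,j) + (\<gamma> - a0) else a (i,j))
         in facet_defining (arcsDn n) (Pcycle n p) b \<gamma>"
proof -
  have p2: "2 \<le> p" and n0: "0 < n" and p0: "real p \<noteq> 0"
    using assms(1,2) by auto
  define G where "G = {(\<Sum>e\<in>cycle_arcs vs. a e) | vs. is_p_cycle (arcsD n) p vs}"
  define \<gamma> where "\<gamma> = Max G"
  define b where "b = (\<lambda>(i,j). if i = n then a (0,j) + (\<gamma> - a0) else a (i,j))"
  define X where "X = {incid (path_arcs vs) | vs. is_st_p_path (arcsD n) 0 n p vs}"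
  define I where "I = {incid (cycle_arcs vs) | vs. is_p_cycle (arcsD n) p vs}"
  define Y where "Y = {incid (cycle_arcs vs) | vs. is_p_cycle (arcsDn n) p vs}"
  define P where "P = Ppath n p"
  define Q where "Q = Pcycle n p"
  define F where "F = P \<inter> {x. lin (arcsD n) a x = a0}"
  define F' where "F' = Q \<inter> {x. lin (arcsDn n) b x = \<gamma>}"
  let ?\<phi> = "path_to_cycle n"
  \<comment> \<open>Out-degree of \<open>0\<close>, constantly 1 on \<open>P\<close>; out-degree of
    \<open>n\<close>, its counterpart under \<open>?\<phi>\<close>; and number of arcs, constantly
    \<open>p\<close> on \<open>Q\<close>.\<close>
  let ?src = "\<lambda>(i, j). if i = 0 then 1 else 0 :: real"
  let ?deg = "\<lambda>(i, j). if i = n then 1 else 0 :: real"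
  let ?size = "lin (arcsDn n) (\<lambda>_. 1)"
  have P: "P = conv X" and Q: "Q = conv Y"
    by (simp_all add: P_def X_def Ppath_def Q_def Y_def Pcycle_def)
  have \<phi>X: "?\<phi> ` X = rooted_cycles n p"
    unfolding X_def by (rule image_path_vertices[OF p2 n0])
  have Y: "Y = ?\<phi> ` X \<union> I"
    unfolding Y_def I_def \<phi>X by (rule cycle_vertices_eq[OF p2 n0])
  have finX: "finite X" and finY: "finite Y"
    unfolding X_def Y_def using finite_st_p_paths[OF p2 n0] finite_p_cycles[of n p]
    by (simp_all add: setcompr_eq_image)
  have PX: "P \<subseteq> pt.span X" and QY: "Q \<subseteq> pt.span Y"
    unfolding P Q by (rule conv_subset_span)+

  have "x e = 0" if "x \<in> X" "e \<notin> arcsD n" for x e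
    using that by (auto simp: X_def is_st_p_path_def incid_def)
  then have inj: "inj_on ?\<phi> (pt.span X)"
    by (intro inj_on_path_to_cycle_span n0)
  have \<phi>P: "?\<phi> ` P \<subseteq> Q"
  proof -
    have "inj_on ?\<phi> X"
      using inj pt.span_superset by (rule inj_on_subset)
    then have "?\<phi> ` P \<subseteq> conv (?\<phi> ` X)"
      unfolding P by (intro conv_image_subset linear_path_to_cycle)
    also have "\<dots> \<subseteq> Q"
      unfolding Q Y conv_def by blast
    finally show ?thesis .
  qed
  have dim\<phi>: "pt.dim (?\<phi> ` S) = pt.dim S" if "S \<subseteq> P" for S
  proof (intro dim_image_inj_on linear_path_to_cycle inj_on_subset[OF inj])
    show "pt.span S \<subseteq> pt.span X"
      using that PX by (intro pt.span_minimal pt.subspace_span) auto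
  qed

  have srcX: "lin (arcsD n) ?src x = 1" if "x \<in> X" for x
    using that path_vertex_source_degree[OF p2 n0] unfolding X_def by blast
  have src: "lin (arcsD n) ?src x = 1" if "x \<in> P" for x
    using srcX that unfolding P by (rule lin_conv_eq)
  have deg\<phi>: "lin (arcsDn n) ?deg (?\<phi> x) = lin (arcsD n) ?src x" for x
    unfolding lin_path_to_cycle[OF n0] unfolding lin_def
    by (rule sum.cong) (auto simp: arcsD_def split: if_splits)
  \<comment> \<open>Since \<open>?src\<close> is 1 on \<open>P\<close>, lifting shifts the value by
    \<open>\<gamma> - a0\<close> and so turns equality with \<open>a0\<close> into equality with
    \<open>\<gamma>\<close>.\<close>
  have b\<phi>: "lin (arcsDn n) b (?\<phi> x) = lin (arcsD n) a x + (\<gamma> - a0) * lin (arcsD n) ?src x" for x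
    unfolding lin_path_to_cycle[OF n0] unfolding lin_def sum_distrib_left sum.distrib[symmetric]
    by (rule sum.cong) (auto simp: arcsD_def b_def algebra_simps)
  have sizeY: "?size y = p" if y: "y \<in> Y" for y
  proof -
    obtain vs where vs: "y = incid (cycle_arcs vs)" "is_p_cycle (arcsDn n) p vs"
      using y unfolding Y_def by blast
    then have "vs \<noteq> []" "distinct vs" "length vs = p" "cycle_arcs vs \<subseteq> arcsDn n"
      by (auto simp: is_p_cycle_def)
    then show ?thesis
      by (simp add: vs(1) lin_incid card_cycle_arcs)
  qed
  have size: "?size y = p" if "y \<in> Q" for y
    using sizeY that unfolding Q by (rule lin_conv_eq)

  have "{vs. is_p_cycle (arcsD n) p vs} \<subseteq> {vs. is_p_cycle (arcsDn n) p vs}"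
    by (auto simp: is_p_cycle_arcsD_iff[OF p2] is_p_cycle_arcsDn_iff[OF p2])
  then have "finite {vs. is_p_cycle (arcsD n) p vs}"
    using finite_p_cycles finite_subset by blast
  then have finG: "finite G"
    unfolding G_def by (simp add: setcompr_eq_image)
  \<comment> \<open>By \<open>p < n\<close> the nodes \<open>1\<close> to \<open>p\<close> are
    internal, so the maximum \<open>\<gamma>\<close> is attained.\<close>
  have "is_p_cycle (arcsD n) p [1..<p + 1]"
    using assms(2) by (auto simp: is_p_cycle_arcsD_iff[OF p2])
  then have "G \<noteq> {}"
    unfolding G_def by blast
  then have "\<gamma> \<in> G"
    unfolding \<gamma>_def using finG by (rule Max_in[rotated])
  then obtain cs where cs: "is_p_cycle (arcsD n) p cs" "(\<Sum>e\<in>cycle_arcs cs. a e) = \<gamma>"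
    unfolding G_def by blast
  define z where "z = incid (cycle_arcs cs)"
  have inner: "lin (arcsDn n) b (incid (cycle_arcs vs)) = (\<Sum>e\<in>cycle_arcs vs. a e)"
    "lin (arcsDn n) ?deg (incid (cycle_arcs vs)) = 0"
    if "is_p_cycle (arcsD n) p vs" for vs
  proof -
    have vs: "distinct vs" "length vs = p" "set vs \<subseteq> {1..<n}"
      using that unfolding is_p_cycle_arcsD_iff[OF p2] by blast+
    then have "is_p_cycle (arcsDn n) p vs"
      unfolding is_p_cycle_arcsDn_iff[OF p2] by auto
    then have sub: "cycle_arcs vs \<subseteq> arcsDn n"
      by (simp add: is_p_cycle_def)
    have ne: "i \<noteq> n" if "(i, j) \<in> cycle_arcs vs" for i j
      using cycle_arcs_mem[OF that] vs(3) by auto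
    show "lin (arcsDn n) b (incid (cycle_arcs vs)) = (\<Sum>e\<in>cycle_arcs vs. a e)"
      unfolding lin_incid[OF finite_arcsDn sub]
      by (rule sum.cong) (use ne in \<open>auto simp: b_def\<close>)
    show "lin (arcsDn n) ?deg (incid (cycle_arcs vs)) = 0"
      unfolding lin_incid[OF finite_arcsDn sub]
      by (rule sum.neutral) (use ne in auto)
  qed

  have valid: "lin (arcsD n) a x \<le> a0" if "x \<in> P" for x
    using assms(3) that unfolding facet_defining_def P_def by blast
  \<comment> \<open>Cycles through \<open>n\<close> inherit the bound from the paths; the others
    satisfy it by maximality of \<open>\<gamma>\<close>.\<close>
  have valid': "lin (arcsDn n) b y \<le> \<gamma>" if "y \<in> Q" for y
  proof (rule lin_conv_le)
    show "y \<in> conv Y"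
      using that Q by simp
    fix w assume "w \<in> Y"
    then show "lin (arcsDn n) b w \<le> \<gamma>"
      unfolding Y
    proof
      assume "w \<in> ?\<phi> ` X"
      then obtain x where x: "x \<in> X" "w = ?\<phi> x"
        by blast
      then have "x \<in> P"
        using conv_superset P by blast
      then show ?thesis
        using valid[of x] srcX[OF x(1)] by (simp add: x(2) b\<phi>)
    next
      assume "w \<in> I"
      then obtain vs where vs: "is_p_cycle (arcsD n) p vs" "w = incid (cycle_arcs vs)"
        unfolding I_def by blast
      then have "lin (arcsDn n) b w \<in> G"
        unfolding G_def using inner(1) by blast
      then show ?thesis
        unfolding \<gamma>_def using finG by (rule Max_ge[rotated])
    qed
  qed

  have "pdim F = pdim P - 1"
    using assms(3) unfolding facet_defining_def F_def P_def by blast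
  moreover have "pdim S = int (pt.dim S) - 1" if "S \<subseteq> P" for S
    using that src PX by (intro pdim_eq_dim[OF finX, of S "arcsD n" ?src 1]) auto
  ultimately have dimF: "int (pt.dim F) = int (pt.dim P) - 1"
    by (simp add: F_def)

  have "z \<in> I"
    using cs(1) by (auto simp: I_def z_def)
  then have "z \<in> Y"
    by (simp add: Y)
  then have zQ: "z \<in> Q"
    unfolding Q by (rule subsetD[OF conv_superset])
  have \<phi>F: "?\<phi> ` F \<subseteq> F'"
    using \<phi>P src unfolding F_def F'_def by (auto simp: b\<phi>)
  have "z \<in> F'"
    using zQ inner(1)[OF cs(1)] cs(2) unfolding F'_def z_def by simp
  moreover have "z \<notin> pt.span (?\<phi> ` F)"
  proof
    assume "z \<in> pt.span (?\<phi> ` F)"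
    \<comment> \<open>On the image of \<open>F\<close> the out-degree of \<open>n\<close> is 1 and
      the size is \<open>p\<close>, whereas \<open>z\<close> has out-degree 0 and size
      \<open>p\<close>.\<close>
    moreover have "lin (arcsDn n) ?deg y = (1 / p) * ?size y" if y: "y \<in> ?\<phi> ` F" for y
    proof -
      obtain x where x: "x \<in> P" "y = ?\<phi> x"
        using y unfolding F_def by blast
      then have "?size y = p"
        using \<phi>P size by blast
      then show ?thesis
        using src[OF x(1)] p0 by (simp add: x(2) deg\<phi>)
    qed
    ultimately have "lin (arcsDn n) ?deg z = (1 / p) * ?size z"
      by (rule lin_proportional_on_span[rotated])
    then show False
      using inner(2)[OF cs(1)] size[OF zQ] p0 by (simp add: z_def)
  qed
  moreover have "F' \<subseteq> pt.span Y"
    using QY unfolding F'_def by blast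
  ultimately have "pt.dim (?\<phi> ` F) < pt.dim F'"
    using \<phi>F finY by (intro dim_less)
  then have lower: "pt.dim F < pt.dim F'"
    using dim\<phi>[of F] by (simp add: F_def)

  \<comment> \<open>The single vector \<open>z\<close> suffices: any other cycle avoiding
    \<open>n\<close> differs from it by an element of the span of the cycles through
    \<open>n\<close>.\<close>
  have "Y \<subseteq> pt.span (insert z (?\<phi> ` P))"
  proof
    let ?S = "pt.span (insert z (?\<phi> ` P))"
    have rooted: "?\<phi> ` X \<subseteq> ?\<phi> ` P"
      unfolding P using conv_superset by blast
    fix y assume "y \<in> Y"
    then show "y \<in> ?S"
      unfolding Y
    proof
      assume "y \<in> ?\<phi> ` X"
      then show ?thesis
        using rooted by (intro pt.span_base) blast
    next
      assume "y \<in> I"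
      then obtain vs where vs: "is_p_cycle (arcsD n) p vs" "y = incid (cycle_arcs vs)"
        unfolding I_def by blast
      have "y - z \<in> pt.span (?\<phi> ` X)"
        using vs(1) cs(1) unfolding vs(2) z_def \<phi>X is_p_cycle_arcsD_iff[OF p2]
        by (intro inner_cycles_congruent assms(1,2)) auto
      moreover have "pt.span (?\<phi> ` X) \<subseteq> ?S"
        using rooted by (intro pt.span_mono) blast
      ultimately have "z + (y - z) \<in> ?S"
        by (intro pt.span_add[OF pt.span_base]) auto
      then show ?thesis
        by simp
    qed
  qed
  then have "Q \<subseteq> pt.span (insert z (?\<phi> ` P))"
    using QY pt.span_minimal[OF _ pt.subspace_span] by blast
  moreover have "?\<phi> ` P \<subseteq> pt.span Y"
    using \<phi>P QY by blast
  ultimately have "pt.dim Q \<le> Suc (pt.dim (?\<phi> ` P))"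
    using finY by (intro dim_le_Suc)
  then have upper: "pt.dim Q \<le> Suc (pt.dim P)"
    using dim\<phi>[of P] by simp

  have "F \<noteq> P"
    using dimF by auto
  then obtain x where x: "x \<in> P" "lin (arcsD n) a x \<noteq> a0"
    unfolding F_def by blast
  have \<phi>x: "?\<phi> x \<in> Q"
    using \<phi>P x(1) by blast
  have "?\<phi> x \<notin> pt.span F'"
  proof
    assume "?\<phi> x \<in> pt.span F'"
    \<comment> \<open>On \<open>F'\<close> the functional is \<open>\<gamma>\<close> and the size is
      \<open>p\<close>; the image of \<open>x\<close> has size \<open>p\<close> too, but a value
      other than \<open>\<gamma>\<close>.\<close>
    moreover have "lin (arcsDn n) b y = (\<gamma> / p) * ?size y" if "y \<in> F'" for y
      using that size p0 unfolding F'_def by simp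
    ultimately have "lin (arcsDn n) b (?\<phi> x) = (\<gamma> / p) * ?size (?\<phi> x)"
      by (rule lin_proportional_on_span[rotated])
    then show False
      using x src[OF x(1)] size[OF \<phi>x] p0 by (simp add: b\<phi>)
  qed
  then have strict: "pt.dim F' < pt.dim Q"
    using \<phi>x by (intro dim_less[OF finY QY, of F' "?\<phi> x"]) (auto simp: F'_def)

  have "pdim S = int (pt.dim S) - 1" if "S \<subseteq> Q" for S
    using that size QY p0 by (intro pdim_eq_dim[OF finY, of S "arcsDn n" "\<lambda>_. 1" p]) auto
  \<comment> \<open>The bounds \<open>dim P \<le> dim F' < dim Q \<le> dim P + 1\<close> leave only
    \<open>dim F' = dim P\<close> and \<open>dim Q = dim P + 1\<close>.\<close>
  then have "pdim F' = pdim Q - 1"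
    using lower upper strict dimF by (simp add: F'_def)
  then have "facet_defining (arcsDn n) Q b \<gamma>"
    using valid' unfolding facet_defining_def F'_def by blast
  then show ?thesis
    unfolding Let_def b_def \<gamma>_def G_def Q_def .
qed

end
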